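(* Let $\mathcal{G}_0=(G_0,m,\varphi,\tau)$ be a $\Gamma$-gain framework. The linear span of the joint spectral $\chi$-symmetric vectors for $\mathcal{G}_0$ is the translation space $Z_{\mathcal{G}_0}$.
   Context: $X$ and $Y$ are finite-dimensional complex Hilbert spaces; $\Gamma$ is a finitely generated discrete abelian group written additively; $\hat\Gamma$ is its dual group of characters $\chi:\Gamma\to\mathbb{T}$. $\mathrm{Isom}(X)$ is the group of affine isometries of $X$ (maps $x\mapsto Ux+b$ with $U$ a linear isometry, $b\in X$). For a group homomorphism $\tau:\Gamma\to\mathrm{Isom}(X)$, $d\tau(\gamma)$ denotes the linear part of $\tau(\gamma)$; $d\tau$ is a unitary representation of $\Gamma$ on $X$. A $\Gamma$-gain framework is a tuple $\mathcal{G}_0=(G_0,m,\varphi,\tau)$ where $G_0=(V_0,E_0)$ is a finite directed multigraph with $V_0\ne\emptyset$ (loops and parallel edges allowed), $m:E_0\to\Gamma$ is any map, $\varphi=(\varphi_e)_{e\in E_0}$ is a family of linear maps $X\to Y$, and $\tau:\Gamma\to\mathrm{Isom}(X)$ is a group homomorphism. $\ell^\infty(\Gamma,X^{V_0})$ is the Banach space of bounded functions $\Gamma\to X^{V_0}$ with the supremum norm. For $\chi\in\hat\Gamma$ and $a=(a_v)_{v\in V_0}\in X^{V_0}$, the $\chi$-symmetric vector $z(\chi,a)\in\ell^\infty(\Gamma,X^{V_0})$ is $z(\chi,a)(\gamma)=(\chi(\gamma)d\tau(\gamma)a_v)_{v\in V_0}$. Joint spectrum: for a commuting tuple $T=(T_1,\dots,T_n)$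 of linear operators on $X$, $\sigma(T)$ is the set of joint eigenvalues, i.e. points $\lambda\in\mathbb{C}^n$ for which there is a non-zero $a\in X$ (a joint eigenvector for $\lambda$) with $T_ja=\lambda_ja$ for all $j$. If $\mathcal{A}$ is the unital commutative Banach algebra generated by $T_1,\dots,T_n$ in $B(X)$, then for each $\lambda\in\sigma(T)$ there is a unique non-zero multiplicative linear functional $\psi_\lambda:\mathcal{A}\to\mathbb{C}$ with $\lambda=(\psi_\lambda(T_1),\dots,\psi_\lambda(T_n))$. Let $T=(d\tau(\gamma_1),\dots,d\tau(\gamma_n))$ be a generating $n$-tuple for the group $d\tau(\Gamma)$, i.e. its entries generate $d\tau(\Gamma)$. For $\lambda\in\sigma(T)$, $\chi_\lambda:=\psi_\lambda\circ d\tau\in\hat\Gamma$. A joint spectral $\chi$-symmetric vector for $\mathcal{G}_0$ is a $\chi$-symmetric vector of the form $z(\bar\chi_\lambda,[a\cdots a]^\intercal)$, where $\lambda\in\sigma(T)$ and $a\in X$ is a joint eigenvector for $\lambda$, and $[a\cdots a]^\intercal\in X^{V_0}$ has all components equal to $a$. A translation of $\mathcal{G}_0$ is a function $f\in\ell^\infty(\Gamma,X^{V_0})$ for which there is $a\in X$ with $f(\gamma)=[a\cdots a]^\intercal$ for all $\gamma\in\Gamma$; the translation space $Z_{\mathcal{G}_0}$ is the vector space of all translations of $\mathcal{G}_0$. *)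

theory Defs
  imports
    "HOL-Analysis.Analysis"
    "HOL-Algebra.Generated_Groups"
    "HOL-Library.Function_Algebras"
    "HOL-Library.FuncSet"
    "Graph_Theory.Digraph"
begin

section \<open>Finite-dimensional complex Hilbert spaces\<close>

text \<open>
  The inner product is linear in its first argument. Its real part is the real inner
  product inherited from \<^class>\<open>real_inner\<close>, so the norm and the topology
  are the ones induced by the complex inner product.
\<close>

class complex_inner = real_inner +
  fixes scaleC :: "complex \<Rightarrow> 'a \<Rightarrow> 'a"  (infixr \<open>*\<^sub>C\<close> 75)
    and cinner :: "'a \<Rightarrow> 'a \<Rightarrow> complex"
  assumes scaleC_add_right: "c *\<^sub>C (x + y) = c *\<^sub>C x + c *\<^sub>C y"
    and scaleC_add_left: "(c + d) *\<^sub>C x = c *\<^sub>C x + d *\<^sub>C x"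
    and scaleC_scaleC: "c *\<^sub>C (d *\<^sub>C x) = (c * d) *\<^sub>C x"
    and scaleC_of_real: "complex_of_real r *\<^sub>C x = scaleR r x"
    and cinner_commute: "cinner x y = cnj (cinner y x)"
    and cinner_add_left: "cinner (x + y) z = cinner x z + cinner y z"
    and cinner_scaleC_left: "cinner (c *\<^sub>C x) y = c * cinner x y"
    and Re_cinner: "Re (cinner x y) = inner x y"

lemma scaleC_one: "1 *\<^sub>C x = (x :: 'a :: complex_inner)"
  using scaleC_of_real[of 1 x] by simp

global_interpretation cvec: vector_space "scaleC :: complex \<Rightarrow> 'a \<Rightarrow> 'a :: complex_inner"
  by unfold_locales (simp_all add: scaleC_add_right scaleC_add_left scaleC_scaleC scaleC_one)

text \<open>Completeness is automatic in finite dimension; the zero space is allowed.\<close>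

class fin_dim_hilbert = complex_inner +
  assumes finite_complex_spanning_set:
    "\<exists>B. finite B \<and> (\<forall>x. \<exists>r. x = (\<Sum>b\<in>B. r b *\<^sub>C b))"

lemma fin_dim_hilbert_span:
  "\<exists>B :: 'a::fin_dim_hilbert set. finite B \<and> cvec.span B = UNIV"
proof -
  obtain B :: "'a set" where B: "finite B" "\<And>x. \<exists>r. x = (\<Sum>b\<in>B. r b *\<^sub>C b)"
    using finite_complex_spanning_set by blast
  have "x \<in> cvec.span B" for x
  proof -
    obtain r where "x = (\<Sum>b\<in>B. r b *\<^sub>C b)" using B(2) by blast
    moreover have "(\<Sum>b\<in>B. r b *\<^sub>C b) \<in> cvec.span B"
      by (intro cvec.span_sum cvec.span_scale cvec.span_base)
    ultimately show ?thesis by simp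
  qed
  with B(1) show ?thesis by blast
qed

abbreviation clinear :: "('a::complex_inner \<Rightarrow> 'b::complex_inner) \<Rightarrow> bool" where
  "clinear \<equiv> Vector_Spaces.linear scaleC scaleC"

instantiation complex :: fin_dim_hilbert
begin

definition scaleC_complex :: "complex \<Rightarrow> complex \<Rightarrow> complex" where
  "scaleC_complex c x = c * x"

definition cinner_complex :: "complex \<Rightarrow> complex \<Rightarrow> complex" where
  "cinner_complex x y = x * cnj y"

instance
proof intro_classes
  show "\<exists>B::complex set. finite B \<and> (\<forall>x. \<exists>r. x = (\<Sum>b\<in>B. r b *\<^sub>C b))"
    by (intro exI[of _ "{1}"]) (auto simp: scaleC_complex_def)
qed (simp_all add: scaleC_complex_def cinner_complex_def algebra_simps scaleR_conv_of_real
    inner_complex_def)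

end

instantiation vec :: (complex_inner, finite) complex_inner
begin

definition scaleC_vec :: "complex \<Rightarrow> 'a ^ 'b \<Rightarrow> 'a ^ 'b" where
  "scaleC_vec c x = (\<chi> i. c *\<^sub>C x $ i)"

definition cinner_vec :: "'a ^ 'b \<Rightarrow> 'a ^ 'b \<Rightarrow> complex" where
  "cinner_vec x y = (\<Sum>i\<in>UNIV. cinner (x $ i) (y $ i))"

instance
proof intro_classes
  fix x y :: "'a ^ 'b"
  show "cinner x y = cnj (cinner y x)"
    unfolding cinner_vec_def cnj_sum by (intro sum.cong refl cinner_commute)
qed (simp_all add: scaleC_vec_def cinner_vec_def vec_eq_iff scaleC_add_right scaleC_add_left
    scaleC_scaleC scaleC_of_real cinner_add_left cinner_scaleC_left sum.distrib
    sum_distrib_left Re_cinner inner_vec_def)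

end

instance vec :: (fin_dim_hilbert, finite) fin_dim_hilbert
proof intro_classes
  obtain B :: "'a set" where B: "finite B" "cvec.span B = UNIV"
    using fin_dim_hilbert_span by blast
  let ?A = "(\<lambda>(i, b). axis i b) ` ((UNIV :: 'b set) \<times> B)"
  have ax: "axis i a \<in> cvec.span ?A" for i :: 'b and a :: 'a
  proof -
    have "a \<in> cvec.span B" using B by simp
    then show ?thesis
    proof (induction rule: cvec.span_induct_alt)
      case base
      have "axis i (0::'a) = 0" by (simp add: axis_def vec_eq_iff)
      then show ?case by (simp only: cvec.span_zero)
    next
      case (step c x y)
      have "axis i (c *\<^sub>C x + y) = c *\<^sub>C axis i x + axis i y"
        by (auto simp: axis_def vec_eq_iff scaleC_vec_def)
      moreover have "axis i x \<in> cvec.span ?A" using step by (intro cvec.span_base) auto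
      ultimately show ?case using step by (simp add: cvec.span_add cvec.span_scale)
    qed
  qed
  have "x \<in> cvec.span ?A" for x :: "'a ^ 'b"
  proof -
    have "x = (\<Sum>i\<in>UNIV. axis i (x $ i))"
      by (simp add: vec_eq_iff axis_def)
    then show ?thesis by (metis (no_types, lifting) ax cvec.span_sum)
  qed
  moreover have fin: "finite ?A" using B(1) by auto
  ultimately have "\<forall>x. \<exists>r. x = (\<Sum>b\<in>?A. r b *\<^sub>C b)"
    by (auto simp: cvec.span_finite[OF fin])
  then show "\<exists>A :: ('a ^ 'b) set. finite A \<and> (\<forall>x. \<exists>r. x = (\<Sum>b\<in>A. r b *\<^sub>C b))"
    using fin by (intro exI[of _ ?A]) auto
qed

section \<open>Groups\<close>

definition additive_group :: "'g::ab_group_add monoid" where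
  "additive_group = \<lparr>carrier = UNIV, monoid.mult = (+), one = 0\<rparr>"

definition finitely_generated :: "'g::ab_group_add itself \<Rightarrow> bool" where
  "finitely_generated _ \<longleftrightarrow>
     (\<exists>S :: 'g set. finite S \<and> generate additive_group S = UNIV)"

definition circle_group :: "complex monoid" where
  "circle_group = \<lparr>carrier = {z. norm z = 1}, monoid.mult = (*), one = 1\<rparr>"

text \<open>The group is discrete, so no continuity is required of its characters.\<close>

definition dual_group :: "('g::ab_group_add \<Rightarrow> complex) set" where
  "dual_group = hom additive_group circle_group"

definition linear_isometry :: "('x::complex_inner \<Rightarrow> 'x) \<Rightarrow> bool" where
  "linear_isometry U \<longleftrightarrow> clinear U \<and> (\<forall>x. norm (U x) = norm x)"

text \<open>In finite dimension the linear isometries of a space into itself are the unitaries.\<close>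

definition unitary_group :: "('x::fin_dim_hilbert \<Rightarrow> 'x) monoid" where
  "unitary_group = \<lparr>carrier = {U. linear_isometry U}, monoid.mult = (\<circ>), one = id\<rparr>"

definition isometry_group :: "('x::fin_dim_hilbert \<Rightarrow> 'x) monoid" where
  "isometry_group =
     \<lparr>carrier = {\<lambda>x. U x + b | U b. linear_isometry U}, monoid.mult = (\<circ>), one = id\<rparr>"

definition linear_part :: "('x::complex_inner \<Rightarrow> 'x) \<Rightarrow> 'x \<Rightarrow> 'x" where
  "linear_part f = (\<lambda>x. f x - f 0)"

lemma linear_part_affine:
  assumes "linear_isometry U"
  shows "linear_part (\<lambda>x. U x + b) = U"
proof -
  interpret Vector_Spaces.linear scaleC scaleC U
    using assms by (simp add: linear_isometry_def)
  show ?thesis by (simp add: linear_part_def zero)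
qed

section \<open>Gain frameworks\<close>

text \<open>
  Values of \<open>gain\<close> and \<open>edge_map\<close> outside the arcs of the graph are irrelevant.
\<close>

record ('g, 'x, 'y, 'v, 'e) gain_framework =
  graph_of :: "('v, 'e) pre_digraph"
  gain :: "'e \<Rightarrow> 'g"
  edge_map :: "'e \<Rightarrow> 'x \<Rightarrow> 'y"
  action :: "'g \<Rightarrow> 'x \<Rightarrow> 'x"

definition is_gain_framework ::
  "('g::ab_group_add, 'x::fin_dim_hilbert, 'y::fin_dim_hilbert, 'v, 'e) gain_framework \<Rightarrow> bool"
where
  "is_gain_framework F \<longleftrightarrow>
     fin_digraph (graph_of F) \<and> verts (graph_of F) \<noteq> {} \<and>
     (\<forall>e\<in>arcs (graph_of F). clinear (edge_map F e)) \<and>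
     action F \<in> hom additive_group isometry_group"

abbreviation d_action ::
  "('g, 'x::complex_inner, 'y, 'v, 'e) gain_framework \<Rightarrow> 'g \<Rightarrow> 'x \<Rightarrow> 'x" where
  "d_action F \<gamma> \<equiv> linear_part (action F \<gamma>)"

section \<open>Bounded functions into the vertex-indexed vectors\<close>

text \<open>
  A vector of \<open>X\<^sup>V\<close>, with \<open>V\<close> the vertex set, is represented by a function
  on the type of vertices that vanishes outside \<open>V\<close>.
\<close>

definition vertex_vectors ::
  "('g, 'x::zero, 'y, 'v, 'e) gain_framework \<Rightarrow> ('v \<Rightarrow> 'x) set" where
  "vertex_vectors F = {a. \<forall>v. v \<notin> verts (graph_of F) \<longrightarrow> a v = 0}"

definition const_vector ::
  "('g, 'x::zero, 'y, 'v, 'e) gain_framework \<Rightarrow> 'x \<Rightarrow> 'v \<Rightarrow> 'x" where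
  "const_vector F a = (\<lambda>v. if v \<in> verts (graph_of F) then a else 0)"

definition linfty ::
  "('g, 'x::real_normed_vector, 'y, 'v, 'e) gain_framework \<Rightarrow> ('g \<Rightarrow> 'v \<Rightarrow> 'x) set" where
  "linfty F = {f. (\<forall>\<gamma>. f \<gamma> \<in> vertex_vectors F) \<and> (\<exists>B. \<forall>\<gamma> v. norm (f \<gamma> v) \<le> B)}"

definition fun_scaleC ::
  "complex \<Rightarrow> ('g \<Rightarrow> 'v \<Rightarrow> 'x::complex_inner) \<Rightarrow> 'g \<Rightarrow> 'v \<Rightarrow> 'x" where
  "fun_scaleC c f = (\<lambda>\<gamma> v. c *\<^sub>C f \<gamma> v)"

global_interpretation cfun:
  vector_space "fun_scaleC :: complex \<Rightarrow> ('g \<Rightarrow> 'v \<Rightarrow> 'x::complex_inner) \<Rightarrow> _"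
  by unfold_locales
    (simp_all add: fun_scaleC_def fun_eq_iff scaleC_add_right scaleC_add_left scaleC_scaleC
      scaleC_one)

abbreviation cfun_span ::
  "('g \<Rightarrow> 'v \<Rightarrow> 'x::complex_inner) set \<Rightarrow> ('g \<Rightarrow> 'v \<Rightarrow> 'x) set" where
  "cfun_span \<equiv> module.span fun_scaleC"

definition symmetric_vector ::
  "('g, 'x::complex_inner, 'y, 'v, 'e) gain_framework \<Rightarrow> ('g \<Rightarrow> complex) \<Rightarrow> ('v \<Rightarrow> 'x)
     \<Rightarrow> 'g \<Rightarrow> 'v \<Rightarrow> 'x" where
  "symmetric_vector F ch a = (\<lambda>\<gamma> v. ch \<gamma> *\<^sub>C d_action F \<gamma> (a v))"

definition translation_space ::
  "('g, 'x::real_normed_vector, 'y, 'v, 'e) gain_framework \<Rightarrow> ('g \<Rightarrow> 'v \<Rightarrow> 'x) set" where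
  "translation_space F = {f \<in> linfty F. \<exists>a. \<forall>\<gamma>. f \<gamma> = const_vector F a}"

section \<open>Joint spectrum\<close>

definition joint_eigenvector ::
  "('x::complex_inner \<Rightarrow> 'x) list \<Rightarrow> complex list \<Rightarrow> 'x \<Rightarrow> bool" where
  "joint_eigenvector T l a \<longleftrightarrow>
     length l = length T \<and> a \<noteq> 0 \<and> (\<forall>j<length T. (T ! j) a = (l ! j) *\<^sub>C a)"

definition joint_spectrum :: "('x::complex_inner \<Rightarrow> 'x) list \<Rightarrow> complex list set" where
  "joint_spectrum T = {l. \<exists>a. joint_eigenvector T l a}"

text \<open>
  Operators are plain functions; addition and scaling are pointwise and the algebra product
  is composition (not the pointwise product of \<open>Function_Algebras\<close>). The last clause
  is closedness in the operator norm.
\<close>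

definition closed_unital_subalgebra :: "('x::fin_dim_hilbert \<Rightarrow> 'x) set \<Rightarrow> bool" where
  "closed_unital_subalgebra A \<longleftrightarrow>
     A \<subseteq> {S. clinear S} \<and> id \<in> A \<and>
     (\<forall>S\<in>A. \<forall>R\<in>A. (\<lambda>x. S x + R x) \<in> A) \<and>
     (\<forall>c. \<forall>S\<in>A. (\<lambda>x. c *\<^sub>C S x) \<in> A) \<and>
     (\<forall>S\<in>A. \<forall>R\<in>A. S \<circ> R \<in> A) \<and>
     (\<forall>S L. (\<forall>n::nat. S n \<in> A) \<longrightarrow> clinear L \<longrightarrow>
        (\<lambda>n. onorm (\<lambda>x. S n x - L x)) \<longlonglongrightarrow> 0 \<longrightarrow> L \<in> A)"

definition generated_algebra ::
  "('x::fin_dim_hilbert \<Rightarrow> 'x) list \<Rightarrow> ('x \<Rightarrow> 'x) set" where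
  "generated_algebra T = closed_unital_subalgebra hull set T"

text \<open>
  Functionals on an algebra \<open>A\<close> are made extensional on \<open>A\<close>, so that the
  one determined by a point of the joint spectrum is unique as a HOL function.
\<close>

definition multiplicative_functional ::
  "('x::complex_inner \<Rightarrow> 'x) set \<Rightarrow> (('x \<Rightarrow> 'x) \<Rightarrow> complex) \<Rightarrow> bool" where
  "multiplicative_functional A \<psi> \<longleftrightarrow>
     \<psi> \<in> extensional A \<and> (\<exists>S\<in>A. \<psi> S \<noteq> 0) \<and>
     (\<forall>S\<in>A. \<forall>R\<in>A. \<psi> (\<lambda>x. S x + R x) = \<psi> S + \<psi> R) \<and>
     (\<forall>c. \<forall>S\<in>A. \<psi> (\<lambda>x. c *\<^sub>C S x) = c * \<psi> S) \<and>
     (\<forall>S\<in>A. \<forall>R\<in>A. \<psi> (S \<circ> R) = \<psi> S * \<psi> R)"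

definition spectral_functional ::
  "('x::fin_dim_hilbert \<Rightarrow> 'x) list \<Rightarrow> complex list \<Rightarrow> ('x \<Rightarrow> 'x) \<Rightarrow> complex" where
  "spectral_functional T l =
     (THE \<psi>. multiplicative_functional (generated_algebra T) \<psi> \<and> l = map \<psi> T)"

definition spectral_character ::
  "('g, 'x::fin_dim_hilbert, 'y, 'v, 'e) gain_framework \<Rightarrow> ('x \<Rightarrow> 'x) list \<Rightarrow> complex list
     \<Rightarrow> 'g \<Rightarrow> complex" where
  "spectral_character F T l = spectral_functional T l \<circ> d_action F"

definition generating_tuple ::
  "('g, 'x::fin_dim_hilbert, 'y, 'v, 'e) gain_framework \<Rightarrow> ('x \<Rightarrow> 'x) list \<Rightarrow> bool" where
  "generating_tuple F T \<longleftrightarrow>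
     set T \<subseteq> range (d_action F) \<and> generate unitary_group (set T) = range (d_action F)"

definition joint_spectral_symmetric_vectors ::
  "('g::ab_group_add, 'x::fin_dim_hilbert, 'y, 'v, 'e) gain_framework \<Rightarrow> ('x \<Rightarrow> 'x) list
     \<Rightarrow> ('g \<Rightarrow> 'v \<Rightarrow> 'x) set" where
  "joint_spectral_symmetric_vectors F T =
     {symmetric_vector F ch (const_vector F a) | ch l a.
        ch \<in> dual_group \<and> ch = (\<lambda>\<gamma>. cnj (spectral_character F T l \<gamma>)) \<and>
        l \<in> joint_spectrum T \<and> joint_eigenvector T l a}"

end

theory Submission
  imports Defs "HOL-Computational_Algebra.Fundamental_Theorem_Algebra"
begin

text \<open>
  If \<open>a\<close> is a joint eigenvector for \<open>\<lambda>\<close>, then \<open>d\<tau>(\<gamma>) a = \<chi>\<^sub>\<lambda>(\<gamma>) a\<close>, and since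
  \<open>\<chi>\<^sub>\<lambda>(\<gamma>)\<close> has modulus one, the conjugate character cancels it: the joint spectral symmetric
  vectors are exactly the translations by joint eigenvectors. These span, because commuting
  isometries have a common orthonormal eigenbasis. The same eigenbasis diagonalises the
  generated algebra, which forces every multiplicative functional to be evaluation at one of
  its elements (so \<open>\<psi>\<^sub>\<lambda>\<close> is unique) and puts the inverses of the generators into the algebra
  (so \<open>\<psi>\<^sub>\<lambda>\<close> is defined on all of \<open>d\<tau>(\<Gamma>)\<close>).
\<close>

section \<open>Complex inner products: norm, estimates and continuity\<close>

lemma cinner_scaleC_right: "cinner x (c *\<^sub>C y) = cnj c * cinner x y"
  by (metis cinner_commute cinner_scaleC_left complex_cnj_mult)

lemma cinner_zero_left [simp]: "cinner 0 x = 0"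
  using cinner_add_left[of 0 0 x] by simp

lemma cinner_diff_left: "cinner (x - y) z = cinner x z - cinner y z"
  using cinner_add_left[of "x - y" y z] by simp

lemma cinner_sum_left: "cinner (\<Sum>i\<in>I. f i) x = (\<Sum>i\<in>I. cinner (f i) x)"
  by (induction I rule: infinite_finite_induct) (simp_all add: cinner_add_left)

lemma cinner_self: "cinner x x = complex_of_real ((norm x)\<^sup>2)"
proof (rule complex_eqI)
  have "cnj (cinner x x) = cinner x x" by (metis cinner_commute)
  then show "Im (cinner x x) = Im (complex_of_real ((norm x)\<^sup>2))"
    by (simp add: complex_eq_iff)
qed (simp add: Re_cinner power2_norm_eq_inner)

lemma cinner_self_eq_0_iff [simp]: "cinner x x = 0 \<longleftrightarrow> x = 0"
  by (simp add: cinner_self)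

text \<open>The class relates only the real part of \<open>cinner\<close> to \<open>inner\<close>.
  The imaginary part is recovered by replacing \<open>y\<close> with its multiple by the imaginary
  unit. Facts about \<open>inner\<close> (Cauchy-Schwarz, limits, polarisation) carry over to
  \<open>cinner\<close> this way.\<close>

lemma cinner_eq_Complex: "cinner x y = Complex (inner x y) (inner x (\<i> *\<^sub>C y))"
  by (simp add: complex_eq_iff flip: Re_cinner) (simp add: cinner_scaleC_right)

lemma norm_scaleC: "norm (c *\<^sub>C x) = cmod c * norm (x :: 'a :: complex_inner)"
proof -
  have "complex_of_real ((norm (c *\<^sub>C x))\<^sup>2) = complex_of_real ((cmod c * norm x)\<^sup>2)"
    unfolding cinner_self[symmetric] cinner_scaleC_left cinner_scaleC_right
    by (simp only: power_mult_distrib of_real_mult complex_norm_square cinner_self flip: of_real_power)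
      (simp add: mult_ac)
  then have "(norm (c *\<^sub>C x))\<^sup>2 = (cmod c * norm x)\<^sup>2"
    by (simp only: of_real_eq_iff)
  then show ?thesis
    by (simp add: power2_eq_iff_nonneg)
qed

text \<open>The factor 2 arises from bounding real and imaginary parts separately. Any constant
  would do for the boundedness of linear maps.\<close>

lemma cmod_cinner_le: "cmod (cinner x y) \<le> 2 * norm x * norm y"
proof -
  have "cmod (cinner x y) \<le> \<bar>inner x y\<bar> + \<bar>inner x (\<i> *\<^sub>C y)\<bar>"
    using cmod_le[of "cinner x y"] by (simp add: cinner_eq_Complex)
  also have "\<dots> \<le> norm x * norm y + norm x * norm (\<i> *\<^sub>C y)"
    by (intro add_mono Cauchy_Schwarz_ineq2)
  finally show ?thesis by (simp add: norm_scaleC)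
qed

lemma tendsto_cinner_left:
  "(f \<longlongrightarrow> l) G \<Longrightarrow> ((\<lambda>n. cinner (f n) y) \<longlongrightarrow> cinner l y) G"
  unfolding cinner_eq_Complex by (intro tendsto_intros)

lemma tendsto_scaleC_left:
  assumes "(c \<longlongrightarrow> l) G"
  shows "((\<lambda>n. c n *\<^sub>C x) \<longlongrightarrow> l *\<^sub>C (x :: 'a :: complex_inner)) G"
proof -
  have eq: "d *\<^sub>C x = Re d *\<^sub>R x + Im d *\<^sub>R (\<i> *\<^sub>C x)" for d
  proof -
    have "d *\<^sub>C x = (complex_of_real (Re d) + complex_of_real (Im d) * \<i>) *\<^sub>C x"
      by (simp add: complex_eq_iff)
    also have "\<dots> = Re d *\<^sub>R x + Im d *\<^sub>R (\<i> *\<^sub>C x)"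
      by (simp only: scaleC_add_left scaleC_of_real flip: scaleC_scaleC)
    finally show ?thesis .
  qed
  have "((\<lambda>n. Re (c n) *\<^sub>R x + Im (c n) *\<^sub>R (\<i> *\<^sub>C x)) \<longlongrightarrow>
      Re l *\<^sub>R x + Im l *\<^sub>R (\<i> *\<^sub>C x)) G"
    by (intro tendsto_intros assms)
  then show ?thesis by (simp only: eq[symmetric])
qed

text \<open>Makes dimension arguments available. The basis has to be a closed term, hence the
  extension of the empty independent set; it is finite because an independent set is no larger than
  a finite spanning set.\<close>

interpretation cfin: finite_dimensional_vector_space
  "scaleC :: complex \<Rightarrow> 'a \<Rightarrow> 'a :: fin_dim_hilbert" "cvec.extend_basis {}"
proof
  have ind: "cvec.independent ({} :: 'a set)"
    by (simp add: cvec.independent_empty)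
  show "cvec.independent (cvec.extend_basis ({} :: 'a set))"
    "cvec.span (cvec.extend_basis ({} :: 'a set)) = UNIV"
    using cvec.independent_extend_basis[OF ind] cvec.span_extend_basis[OF ind] by auto
  obtain B :: "'a set" where "finite B" "cvec.span B = UNIV"
    using fin_dim_hilbert_span by blast
  with cvec.independent_extend_basis[OF ind] show "finite (cvec.extend_basis ({} :: 'a set))"
    by (metis cvec.independent_span_bound top_greatest)
qed


section \<open>Diagonalising commuting isometries\<close>

text \<open>The vector p(U) x, where powers of \<open>U\<close> are iterates.\<close>

definition poly_action :: "('a::complex_inner \<Rightarrow> 'a) \<Rightarrow> complex poly \<Rightarrow> 'a \<Rightarrow> 'a" where
  "poly_action U p x = (\<Sum>i\<le>degree p. coeff p i *\<^sub>C (U ^^ i) x)"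

lemma poly_action_altdef:
  assumes "degree p \<le> n"
  shows "poly_action U p x = (\<Sum>i\<le>n. coeff p i *\<^sub>C (U ^^ i) x)"
  unfolding poly_action_def
  by (rule sum.mono_neutral_left) (use assms in \<open>auto simp: coeff_eq_0\<close>)

text \<open>Multiplying \<open>q\<close> by X shifts its coefficients by one place, which pulls one
  \<open>U\<close> out of the sum by linearity. \<open>Suc n\<close> serves as a common summation
  bound for both parts.\<close>

lemma poly_action_linear_factor:
  assumes "clinear U"
  shows "poly_action U ([:-r, 1:] * q) x = U (poly_action U q x) - r *\<^sub>C poly_action U q x"
proof -
  interpret U: Vector_Spaces.linear scaleC scaleC U by fact
  define n where "n = degree q"
  have p: "[:-r, 1:] * q = pCons 0 q - smult r q"
    by simp
  have "poly_action U ([:-r, 1:] * q) x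
      = (\<Sum>i\<le>Suc n. coeff ([:-r, 1:] * q) i *\<^sub>C (U ^^ i) x)"
    by (rule poly_action_altdef)
      (use degree_mult_le[of "[:-r, 1:]" q] in \<open>simp add: n_def\<close>)
  also have "\<dots> = (\<Sum>i\<le>Suc n. coeff (pCons 0 q) i *\<^sub>C (U ^^ i) x)
      - (\<Sum>i\<le>Suc n. (r * coeff q i) *\<^sub>C (U ^^ i) x)"
    unfolding p by (simp only: coeff_diff coeff_smult cvec.scale_left_diff_distrib sum_subtractf)
  also have "(\<Sum>i\<le>Suc n. coeff (pCons 0 q) i *\<^sub>C (U ^^ i) x)
      = (\<Sum>i\<le>n. coeff q i *\<^sub>C U ((U ^^ i) x))"
    by (subst sum.atMost_Suc_shift) simp
  also have "\<dots> = U (poly_action U q x)"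
    by (simp add: poly_action_def n_def U.sum U.scale)
  also have "(\<Sum>i\<le>Suc n. (r * coeff q i) *\<^sub>C (U ^^ i) x) = r *\<^sub>C poly_action U q x"
    by (subst poly_action_altdef[of q "Suc n"])
      (simp_all only: n_def le_SucI order_refl cvec.scale_sum_right scaleC_scaleC)
  finally show ?thesis .
qed

lemma poly_action_invariant:
  assumes "cvec.subspace W" "\<And>x. x \<in> W \<Longrightarrow> U x \<in> W" "x \<in> W"
  shows "poly_action U p x \<in> W"
proof -
  have "(U ^^ i) x \<in> W" for i
    by (induction i) (use assms in auto)
  then show ?thesis
    unfolding poly_action_def using assms(1)
    by (intro cvec.subspace_sum cvec.subspace_scale) auto
qed

text \<open>The coefficients of a vanishing combination of iterates of \<open>x\<close> form an
  annihilating polynomial. If only the zero polynomial annihilated \<open>x\<close>, the first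
  \<open>card B + 1\<close> iterates would be independent, too many for the spanning set
  \<open>B\<close>.\<close>

lemma ex_annihilating_poly:
  fixes x :: "'a::fin_dim_hilbert"
  shows "\<exists>p. p \<noteq> 0 \<and> poly_action U p x = 0"
proof (rule ccontr)
  assume no: "\<nexists>p. p \<noteq> 0 \<and> poly_action U p x = 0"
  obtain B :: "'a set" where B: "finite B" "cvec.span B = UNIV"
    using fin_dim_hilbert_span by blast
  let ?I = "{..card B}" and ?g = "\<lambda>i. (U ^^ i) x"
  have zero: "c i = 0" if "(\<Sum>i\<in>?I. c i *\<^sub>C ?g i) = 0" "i \<in> ?I" for c i
  proof -
    define p where "p = (\<Sum>i\<in>?I. monom (c i) i)"
    have coeff: "coeff p i = (if i \<in> ?I then c i else 0)" for i
      by (simp add: p_def coeff_sum)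
    have "degree p \<le> card B"
      by (rule degree_le) (simp add: coeff)
    then have "poly_action U p x = 0"
      using that(1) by (simp add: poly_action_altdef coeff)
    then have "p = 0" using no by blast
    then show ?thesis using coeff[of i] that(2) by simp
  qed
  \<comment> \<open>Independence of the image set does not rule out repeated iterates, so they are
    excluded separately: a repetition is a relation with coefficients 1 and -1.\<close>
  have inj: "inj_on ?g ?I"
  proof (rule inj_onI, rule ccontr)
    fix i j assume ij: "i \<in> ?I" "j \<in> ?I" "?g i = ?g j" "i \<noteq> j"
    define c :: "nat \<Rightarrow> complex" where "c k = (if k = i then 1 else 0) - (if k = j then 1 else 0)" for k
    have "(\<Sum>k\<in>?I. c k *\<^sub>C ?g k) = (\<Sum>k\<in>?I. (if k = i then ?g k else 0) - (if k = j then ?g k else 0))"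
      by (rule sum.cong) (auto simp: c_def scaleC_one cvec.scale_left_diff_distrib)
    also have "\<dots> = 0"
      unfolding sum_subtractf using ij by (simp del: sum_subtractf)
    finally have "c i = 0" using zero ij(1) by blast
    then show False using ij(4) by (simp add: c_def)
  qed
  have "cvec.independent (?g ` ?I)"
  proof (rule cvec.independent_if_scalars_zero)
    fix f y assume "(\<Sum>y\<in>?g ` ?I. f y *\<^sub>C y) = 0" "y \<in> ?g ` ?I"
    then show "f y = 0"
      using zero[of "\<lambda>i. f (?g i)"] by (auto simp: sum.reindex[OF inj])
  qed simp
  then have "card (?g ` ?I) \<le> card B"
    using cvec.independent_span_bound[OF B(1)] B(2) by blast
  then show False by (simp add: card_image[OF inj])
qed

text \<open>Linear factors are split off a polynomial annihilating some nonzero \<open>w\<close> in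
  \<open>W\<close>. As soon as the cofactor \<open>q\<close> no longer annihilates \<open>w\<close>,
  the vector q(U) w is an eigenvector for the root just removed, and invariance keeps it in
  \<open>W\<close>.\<close>

lemma ex_eigenvector:
  fixes W :: "'a::fin_dim_hilbert set"
  assumes "clinear U" "cvec.subspace W" "\<And>x. x \<in> W \<Longrightarrow> U x \<in> W" "W \<noteq> {0}"
  shows "\<exists>x\<in>W. \<exists>c. x \<noteq> 0 \<and> U x = c *\<^sub>C x"
proof -
  obtain w where w: "w \<in> W" "w \<noteq> 0"
    using assms(4) cvec.subspace_0[OF assms(2)] by blast
  have "\<exists>x\<in>W. \<exists>c. x \<noteq> 0 \<and> U x = c *\<^sub>C x" if "p \<noteq> 0" "poly_action U p w = 0" for p
    using that
  proof (induction "degree p" arbitrary: p rule: less_induct)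
    case less
    show ?case
    proof (cases "degree p = 0")
      \<comment> \<open>A nonzero constant cannot annihilate \<open>w\<close>, so this case is
        contradictory.\<close>
      case True
      then obtain c where "p = [:c:]" by (rule degree_eq_zeroE)
      with less.prems w show ?thesis by (simp add: poly_action_def)
    next
      case False
      then obtain r where "poly p r = 0"
        using fundamental_theorem_of_algebra[of p] constant_degree[of p] by auto
      then obtain q where q: "p = [:-r, 1:] * q"
        by (metis dvdE poly_eq_0_iff_dvd)
      have q0: "q \<noteq> 0" using q less.prems(1) by auto
      have "degree q < degree p"
        unfolding q using q0 by (subst degree_mult_eq) auto
      have eig: "U (poly_action U q w) = r *\<^sub>C poly_action U q w"
        using less.prems(2) poly_action_linear_factor[OF assms(1), of r q w] q by simp
      show ?thesis
      proof (cases "poly_action U q w = 0")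
        case True
        show ?thesis by (rule less.hyps[OF \<open>degree q < degree p\<close> q0 True])
      next
        case False
        then show ?thesis
          using eig by (intro bexI[OF _ poly_action_invariant[OF assms(2,3) w(1)]] exI conjI)
      qed
    qed
  qed
  moreover obtain p where "p \<noteq> 0" "poly_action U p w = 0"
    using ex_annihilating_poly[of U w] by blast
  ultimately show ?thesis by blast
qed

text \<open>Take a nonzero invariant subspace \<open>M\<close> of \<open>W\<close> of least
  dimension. For each operator, an eigenspace inside \<open>M\<close> is nonzero and, by
  commutativity, invariant under the whole family, so it equals \<open>M\<close>. Hence every
  operator is scalar on \<open>M\<close>. The family may be infinite.\<close>

lemma ex_common_eigenvector:
  fixes W :: "'a::fin_dim_hilbert set"
  assumes lin: "\<And>U. U \<in> \<U> \<Longrightarrow> clinear U"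
    and comm: "\<And>U V x. U \<in> \<U> \<Longrightarrow> V \<in> \<U> \<Longrightarrow> U (V x) = V (U x)"
    and W: "cvec.subspace W" "\<And>U x. U \<in> \<U> \<Longrightarrow> x \<in> W \<Longrightarrow> U x \<in> W" "W \<noteq> {0}"
  shows "\<exists>x\<in>W. x \<noteq> 0 \<and> (\<forall>U\<in>\<U>. \<exists>c. U x = c *\<^sub>C x)"
proof -
  define P where "P M \<longleftrightarrow>
    cvec.subspace M \<and> M \<subseteq> W \<and> M \<noteq> {0} \<and> (\<forall>U\<in>\<U>. \<forall>x\<in>M. U x \<in> M)" for M
  have "P W" using W by (auto simp: P_def)
  then obtain M where M: "P M" and min: "\<And>N. P N \<Longrightarrow> cvec.dim M \<le> cvec.dim N"
    using arg_min_natI[of P W cvec.dim] arg_min_nat_le[of P _ cvec.dim] by metis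
  have scalar: "\<exists>c. \<forall>x\<in>M. U x = c *\<^sub>C x" if U: "U \<in> \<U>" for U
  proof -
    interpret U: Vector_Spaces.linear scaleC scaleC U using lin[OF U] .
    obtain y c where y: "y \<in> M" "y \<noteq> 0" "U y = c *\<^sub>C y"
      using ex_eigenvector[OF lin[OF U], of M] M U by (auto simp: P_def)
    define N where "N = {x \<in> M. U x = c *\<^sub>C x}"
    have sub: "cvec.subspace N"
      using M by (auto simp: N_def P_def cvec.subspace_def U.add U.scale U.zero
          scaleC_add_right scaleC_scaleC mult.commute)
    have "V x \<in> N" if "V \<in> \<U>" "x \<in> N" for V x
    proof -
      interpret V: Vector_Spaces.linear scaleC scaleC V using lin[OF that(1)] .
      show ?thesis
        using that M comm[OF U that(1)] by (auto simp: N_def P_def V.scale)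
    qed
    then have "P N"
      using sub M y by (auto simp: P_def N_def)
    then have "N = M"
      using cfin.subspace_dim_equal[of N M] min sub M by (auto simp: N_def P_def)
    then show ?thesis by (auto simp: N_def)
  qed
  have "0 \<in> M" "M \<noteq> {0}" "M \<subseteq> W"
    using M cvec.subspace_0[of M] by (simp_all add: P_def)
  then obtain x where x: "x \<in> M" "x \<noteq> 0" by blast
  show ?thesis
  proof (intro bexI conjI ballI)
    show "x \<in> W" using x \<open>M \<subseteq> W\<close> by blast
    show "\<exists>c. U x = c *\<^sub>C x" if "U \<in> \<U>" for U
      using scalar[OF that] x by blast
  qed (rule x)
qed

section \<open>Orthonormal bases of common eigenvectors\<close>

definition orthonormal :: "'a::complex_inner set \<Rightarrow> bool" where
  "orthonormal E \<longleftrightarrow> (\<forall>x\<in>E. \<forall>y\<in>E. cinner x y = (if x = y then 1 else 0))"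

lemma orthonormal_independent:
  assumes "orthonormal E" "finite E"
  shows "cvec.independent E"
proof (rule cvec.independent_if_scalars_zero)
  fix f y assume "(\<Sum>x\<in>E. f x *\<^sub>C x) = 0" "y \<in> E"
  then have "0 = cinner (\<Sum>x\<in>E. f x *\<^sub>C x) y" by simp
  also have "\<dots> = (\<Sum>x\<in>E. if x = y then f x else 0)"
    unfolding cinner_sum_left using assms \<open>y \<in> E\<close>
    by (intro sum.cong) (auto simp: orthonormal_def cinner_scaleC_left)
  finally show "f y = 0" using assms \<open>y \<in> E\<close> by simp
qed fact

text \<open>Polarisation expresses \<open>inner\<close> through norms; applying this to
  \<open>y\<close> and to its multiple by the imaginary unit gives the complex statement.\<close>

lemma linear_isometry_cinner:
  assumes "linear_isometry U"
  shows "cinner (U x) (U y) = cinner x y"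
proof -
  interpret U: Vector_Spaces.linear scaleC scaleC U
    using assms by (simp add: linear_isometry_def)
  have nrm: "norm (U z) = norm z" for z
    using assms by (simp add: linear_isometry_def)
  have "inner (U a) (U b) = inner a b" for a b
    using nrm[of "a + b"] by (simp add: dot_norm nrm flip: U.add)
  then show ?thesis
    by (simp add: cinner_eq_Complex flip: U.scale)
qed

lemma linear_isometry_eigenvalue:
  assumes "linear_isometry U" "U x = c *\<^sub>C x" "x \<noteq> 0"
  shows "cmod c = 1"
proof -
  have "norm (c *\<^sub>C x) = norm x"
    using assms(1) unfolding linear_isometry_def assms(2)[symmetric] by blast
  then show ?thesis using assms(3) by (simp add: norm_scaleC)
qed

text \<open>\<open>E\<close> is a largest orthonormal set of common eigenvectors. Its orthogonal
  complement \<open>W\<close> is invariant; were it nonzero, a normalised common eigenvector in it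
  would enlarge \<open>E\<close>. With \<open>W\<close> trivial, every vector equals its Fourier
  expansion.\<close>

lemma ex_orthonormal_eigenbasis:
  fixes \<U> :: "('a::fin_dim_hilbert \<Rightarrow> 'a) set"
  assumes iso: "\<And>U. U \<in> \<U> \<Longrightarrow> linear_isometry U"
    and comm: "\<And>U V x. U \<in> \<U> \<Longrightarrow> V \<in> \<U> \<Longrightarrow> U (V x) = V (U x)"
  obtains E where "finite E" "\<And>e. e \<in> E \<Longrightarrow> norm e = 1"
    "\<And>x. x = (\<Sum>e\<in>E. cinner x e *\<^sub>C e)"
    "\<And>U e. U \<in> \<U> \<Longrightarrow> e \<in> E \<Longrightarrow> \<exists>c. U e = c *\<^sub>C e"
proof -
  obtain B :: "'a set" where B: "finite B" "cvec.span B = UNIV"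
    using fin_dim_hilbert_span by blast
  define P where "P E \<longleftrightarrow>
    finite E \<and> orthonormal E \<and> (\<forall>U\<in>\<U>. \<forall>e\<in>E. \<exists>c. U e = c *\<^sub>C e)" for E :: "'a set"
  \<comment> \<open>Orthonormal sets are independent, so their sizes are bounded and a largest one
    exists.\<close>
  have bound: "card E < Suc (card B)" if "P E" for E
    using that cvec.independent_span_bound[OF B(1), of E] orthonormal_independent[of E] B(2)
    by (auto simp: P_def)
  have "P {}" by (simp add: P_def orthonormal_def)
  then obtain E where E: "P E" and max: "\<And>E'. P E' \<Longrightarrow> card E' \<le> card E"
    using ex_has_greatest_nat[of P "{}" card "Suc (card B)"] bound by (metis less_imp_le)
  have fin: "finite E" and on: "orthonormal E" using E by (auto simp: P_def)
  have nrm: "norm e = 1" if "e \<in> E" for e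
  proof -
    have "complex_of_real ((norm e)\<^sup>2) = 1"
      using on that cinner_self[of e] by (simp add: orthonormal_def)
    then have "(norm e)\<^sup>2 = 1" by (simp only: of_real_eq_1_iff)
    then show ?thesis using norm_ge_zero[of e] by (simp only: power2_eq_1_iff) linarith
  qed
  define W where "W = {x. \<forall>e\<in>E. cinner x e = 0}"
  have "W = {0}"
  proof (rule ccontr)
    assume "W \<noteq> {0}"
    moreover have "cvec.subspace W"
      by (auto simp: W_def cvec.subspace_def cinner_add_left cinner_scaleC_left)
    moreover have "U x \<in> W" if U: "U \<in> \<U>" and x: "x \<in> W" for U x
    proof -
      have "cinner (U x) e = 0" if e: "e \<in> E" for e
      proof -
        obtain c where c: "U e = c *\<^sub>C e" using E U e by (auto simp: P_def)
        \<comment> \<open>Only \<open>c \<noteq> 0\<close> matters here: the inner product of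
          \<open>x\<close> and \<open>e\<close> is zero and is preserved by \<open>U\<close>, which
          gives the next equation.\<close>
        have "cmod c = 1"
          using linear_isometry_eigenvalue[OF iso[OF U] c] nrm[OF e] by force
        moreover have "cnj c * cinner (U x) e = 0"
          using linear_isometry_cinner[OF iso[OF U], of x e] x e
          by (simp add: c cinner_scaleC_right W_def)
        ultimately show ?thesis by auto
      qed
      then show ?thesis by (simp add: W_def)
    qed
    ultimately obtain x where x: "x \<in> W" "x \<noteq> 0" "\<forall>U\<in>\<U>. \<exists>c. U x = c *\<^sub>C x"
      using ex_common_eigenvector[of \<U> W] iso comm by (auto simp: linear_isometry_def)
    define y where "y = complex_of_real (inverse (norm x)) *\<^sub>C x"
    have y1: "cinner y y = 1"
      using x(2) by (simp add: y_def cinner_self norm_scaleC norm_inverse)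
    have yE: "cinner y e = 0" "cinner e y = 0" if "e \<in> E" for e
    proof -
      show "cinner y e = 0"
        using x(1) that by (simp add: y_def W_def cinner_scaleC_left)
      then show "cinner e y = 0" by (metis cinner_commute complex_cnj_zero)
    qed
    have "y \<notin> E" using y1 yE by force
    have "\<exists>c. U y = c *\<^sub>C y" if U: "U \<in> \<U>" for U
    proof -
      interpret U: Vector_Spaces.linear scaleC scaleC U
        using iso[OF U] by (simp add: linear_isometry_def)
      obtain c where "U x = c *\<^sub>C x" using x U by blast
      then show ?thesis
        by (intro exI[of _ c]) (simp add: y_def U.scale scaleC_scaleC mult.commute)
    qed
    then have "P (insert y E)"
      using E y1 yE \<open>y \<notin> E\<close> by (auto simp: P_def orthonormal_def)
    then show False using max[of "insert y E"] \<open>y \<notin> E\<close> fin by simp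
  qed
  have expand: "x = (\<Sum>e\<in>E. cinner x e *\<^sub>C e)" for x
  proof -
    have "cinner (\<Sum>e\<in>E. cinner x e *\<^sub>C e) f = cinner x f" if "f \<in> E" for f
    proof -
      have "cinner (\<Sum>e\<in>E. cinner x e *\<^sub>C e) f = (\<Sum>e\<in>E. if e = f then cinner x e else 0)"
        unfolding cinner_sum_left using on that
        by (intro sum.cong) (auto simp: orthonormal_def cinner_scaleC_left)
      then show ?thesis using fin that by simp
    qed
    then have "x - (\<Sum>e\<in>E. cinner x e *\<^sub>C e) \<in> W"
      by (simp add: W_def cinner_diff_left)
    then show ?thesis using \<open>W = {0}\<close> by simp
  qed
  show ?thesis
  proof (rule that)
    show "\<exists>c. U e = c *\<^sub>C e" if "U \<in> \<U>" "e \<in> E" for U e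
      using E that by (auto simp: P_def)
  qed (fact fin nrm expand)+
qed

text \<open>For the empty family the eigenbasis is just an orthonormal basis, and \<open>S x\<close>
  is bounded through the coordinates of \<open>x\<close>. Boundedness is what lets
  \<open>onorm\<close> control pointwise values in the closure argument below.\<close>

lemma clinear_imp_bounded_linear:
  fixes S :: "'a::fin_dim_hilbert \<Rightarrow> 'b::complex_inner"
  assumes "clinear S"
  shows "bounded_linear S"
proof -
  interpret S: Vector_Spaces.linear scaleC scaleC S by fact
  show ?thesis
  proof (rule ex_orthonormal_eigenbasis[of "{}"])
    fix E :: "'a set"
    assume E: "finite E" "\<And>e. e \<in> E \<Longrightarrow> norm e = 1" "\<And>x. x = (\<Sum>e\<in>E. cinner x e *\<^sub>C e)"
    show "bounded_linear S"
    proof (rule bounded_linear_intro)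
      show "S (r *\<^sub>R x) = r *\<^sub>R S x" for r x
        using S.scale[of "complex_of_real r" x] by (simp add: scaleC_of_real)
      fix x
      have "S x = S (\<Sum>e\<in>E. cinner x e *\<^sub>C e)"
        by (rule arg_cong[OF E(3)])
      then have "norm (S x) = norm (\<Sum>e\<in>E. cinner x e *\<^sub>C S e)"
        by (simp only: S.sum S.scale)
      also have "\<dots> \<le> (\<Sum>e\<in>E. cmod (cinner x e) * norm (S e))"
        by (rule order_trans[OF norm_sum]) (simp add: norm_scaleC)
      also have "\<dots> \<le> (\<Sum>e\<in>E. 2 * norm x * norm (S e))"
      proof (intro sum_mono mult_right_mono norm_ge_zero)
        show "cmod (cinner x e) \<le> 2 * norm x" if "e \<in> E" for e
          using cmod_cinner_le[of x e] E(2)[OF that] by simp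
      qed
      also have "\<dots> = norm x * (\<Sum>e\<in>E. 2 * norm (S e))"
        by (simp add: sum_distrib_left mult_ac)
      finally show "norm (S x) \<le> norm x * (\<Sum>e\<in>E. 2 * norm (S e))" .
    qed (rule S.add)
  qed auto
qed

lemma clinear_iff:
  "clinear S \<longleftrightarrow> (\<forall>x y. S (x + y) = S x + S y) \<and> (\<forall>c x. S (c *\<^sub>C x) = c *\<^sub>C S x)"
  by (auto simp: Vector_Spaces.linear_iff cvec.vector_space_axioms)


section \<open>The generated algebra and its characters\<close>

text \<open>A set to compare the hull with: if each generator acts on \<open>P\<close> by one
  scalar, so does each element of the generated algebra. The choice of \<open>P\<close> varies:
  empty for all linear maps, a singleton for one eigenvector, a pair for two vectors sharing their
  eigenvalues.\<close>

lemma closed_unital_subalgebra_common_eigenvalue: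
  fixes P :: "'a::fin_dim_hilbert set"
  shows "closed_unital_subalgebra {S. clinear S \<and> (\<exists>c. \<forall>e\<in>P. S e = c *\<^sub>C e)}"
    (is "closed_unital_subalgebra ?A")
proof -
  have id: "id \<in> ?A"
    by (auto simp: clinear_iff intro!: exI[of _ 1] scaleC_one[symmetric])
  have add: "(\<lambda>x. S x + R x) \<in> ?A" if SR: "S \<in> ?A" "R \<in> ?A" for S R
  proof -
    obtain c d where "\<forall>e\<in>P. S e = c *\<^sub>C e" "\<forall>e\<in>P. R e = d *\<^sub>C e" using SR by blast
    then have "\<forall>e\<in>P. S e + R e = (c + d) *\<^sub>C e" by (simp add: scaleC_add_left)
    then show ?thesis using SR by (auto simp: clinear_iff scaleC_add_right add_ac)
  qed
  have scale: "(\<lambda>x. k *\<^sub>C S x) \<in> ?A" if S: "S \<in> ?A" for k S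
  proof -
    obtain c where "\<forall>e\<in>P. S e = c *\<^sub>C e" using S by blast
    then have "\<forall>e\<in>P. k *\<^sub>C S e = (k * c) *\<^sub>C e" by (simp add: scaleC_scaleC)
    then show ?thesis
      using S by (auto simp: clinear_iff scaleC_add_right scaleC_scaleC mult.commute)
  qed
  have comp: "S \<circ> R \<in> ?A" if SR: "S \<in> ?A" "R \<in> ?A" for S R
  proof -
    obtain c d where "\<forall>e\<in>P. S e = c *\<^sub>C e" "\<forall>e\<in>P. R e = d *\<^sub>C e" using SR by blast
    then have "\<forall>e\<in>P. (S \<circ> R) e = (d * c) *\<^sub>C e"
      using SR by (simp add: clinear_iff scaleC_scaleC)
    then show ?thesis using SR by (auto simp: clinear_iff)
  qed
  have limit: "L \<in> ?A" if S: "\<And>n::nat. S n \<in> ?A" and L: "clinear L"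
    and lim: "(\<lambda>n. onorm (\<lambda>x. S n x - L x)) \<longlonglongrightarrow> 0" for S L
  proof -
    have pointwise: "(\<lambda>n. S n x) \<longlonglongrightarrow> L x" for x
    proof (rule Lim_transform2)
      show "(\<lambda>n. L x) \<longlonglongrightarrow> L x" by simp
      have "bounded_linear (\<lambda>x. S n x - L x)" for n
        using S[of n] L by (intro bounded_linear_sub clinear_imp_bounded_linear) auto
      then have le: "norm (S n x - L x) \<le> onorm (\<lambda>x. S n x - L x) * norm x" for n
        by (rule onorm)
      have "(\<lambda>n. S n x - L x) \<longlonglongrightarrow> 0"
        by (rule Lim_null_comparison[OF always_eventually[OF allI[OF le]] tendsto_mult_left_zero[OF lim]])
      from tendsto_minus[OF this] show "(\<lambda>n. L x - S n x) \<longlonglongrightarrow> 0" by simp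
    qed
    have "\<exists>c. \<forall>e\<in>P. L e = c *\<^sub>C e"
    \<comment> \<open>Without a nonzero vector in \<open>P\<close> the scalars of \<open>S n\<close>
      are not determined and need not converge; then any scalar works for \<open>L\<close>.\<close>
    proof (cases "P \<subseteq> {0}")
      case True
      moreover have "L 0 = 0" using Vector_Spaces.linear.axioms(3)[OF L] by (rule module_hom.zero)
      ultimately show ?thesis by (intro exI[of _ 0] ballI) (auto dest: subsetD)
    next
      case False
      then obtain e0 where e0: "e0 \<in> P" "e0 \<noteq> 0" by blast
      have "\<forall>n. \<exists>c. \<forall>e\<in>P. S n e = c *\<^sub>C e" using S by blast
      then obtain c where "\<forall>n. \<forall>e\<in>P. S n e = c n *\<^sub>C e" by (rule choice[THEN exE])
      then have c: "S n e = c n *\<^sub>C e" if "e \<in> P" for n e using that by blast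
      \<comment> \<open>The Rayleigh quotient at one nonzero \<open>e0\<close> recovers the scalars,
        so they converge, and the same limit serves for every vector of \<open>P\<close>.\<close>
      have "c n = cinner (S n e0) e0 / cinner e0 e0" for n
        using e0 by (simp add: c cinner_scaleC_left)
      moreover have "(\<lambda>n. cinner (S n e0) e0 / cinner e0 e0) \<longlonglongrightarrow> cinner (L e0) e0 / cinner e0 e0"
        using e0 by (intro tendsto_divide tendsto_cinner_left pointwise) auto
      ultimately have "c \<longlonglongrightarrow> cinner (L e0) e0 / cinner e0 e0" by presburger
      then have lim_c: "(\<lambda>n. c n *\<^sub>C e) \<longlonglongrightarrow> (cinner (L e0) e0 / cinner e0 e0) *\<^sub>C e" for e
        by (rule tendsto_scaleC_left)
      have "L e = (cinner (L e0) e0 / cinner e0 e0) *\<^sub>C e" if "e \<in> P" for e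
        using LIMSEQ_unique[OF pointwise[of e]] lim_c[of e] by (simp add: c[OF that])
      then show ?thesis by blast
    qed
    then show ?thesis using L by simp
  qed
  show ?thesis
    unfolding closed_unital_subalgebra_def
  proof (intro conjI ballI allI impI)
    show "?A \<subseteq> {S. clinear S}" by blast
    show "L \<in> ?A" if "\<forall>n::nat. S n \<in> ?A" "clinear L"
      "(\<lambda>n. onorm (\<lambda>x. S n x - L x)) \<longlonglongrightarrow> 0" for S L
      using limit[OF spec[OF that(1)] that(2,3)] .
  qed (fact id add scale comp)+
qed

text \<open>The hull is such an intersection. Nonemptiness matters because the empty intersection is
  the set of all functions.\<close>

lemma closed_unital_subalgebra_Inter:
  assumes "\<And>A. A \<in> \<A> \<Longrightarrow> closed_unital_subalgebra A" "\<A> \<noteq> {}"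
  shows "closed_unital_subalgebra (\<Inter>\<A>)"
  unfolding closed_unital_subalgebra_def
proof (intro conjI ballI allI impI)
  show "\<Inter>\<A> \<subseteq> {S. clinear S}"
    using assms by (fastforce simp: closed_unital_subalgebra_def)
next
  fix S L assume "\<forall>n::nat. S n \<in> \<Inter>\<A>" "clinear L" "(\<lambda>n. onorm (\<lambda>x. S n x - L x)) \<longlonglongrightarrow> 0"
  then show "L \<in> \<Inter>\<A>"
    using assms(1) unfolding closed_unital_subalgebra_def by blast
qed (use assms(1) in \<open>simp_all add: closed_unital_subalgebra_def\<close>)

lemma closed_unital_subalgebra_generated:
  assumes "\<And>t. t \<in> set T \<Longrightarrow> clinear t"
  shows "closed_unital_subalgebra (generated_algebra T)"
  unfolding generated_algebra_def hull_def
proof (rule closed_unital_subalgebra_Inter)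
  have "{S. clinear S \<and> (\<exists>c. \<forall>e\<in>{}. S e = c *\<^sub>C e)} \<in> {t. closed_unital_subalgebra t \<and> set T \<subseteq> t}"
    using closed_unital_subalgebra_common_eigenvalue[of "{}"] assms by auto
  then show "{t. closed_unital_subalgebra t \<and> set T \<subseteq> t} \<noteq> {}" by blast
qed simp

text \<open>Keeps what the algebra needs of the eigenbasis: spanning, so that linear maps are
  determined on \<open>E\<close>; nonzero vectors, so that eigenvalues are determined; finiteness,
  for induction over subsets.\<close>

locale diagonalizable_tuple =
  fixes T :: "('a::fin_dim_hilbert \<Rightarrow> 'a) list" and E :: "'a set"
  assumes clinear_T: "t \<in> set T \<Longrightarrow> clinear t"
    and eigen: "t \<in> set T \<Longrightarrow> e \<in> E \<Longrightarrow> \<exists>c. t e = c *\<^sub>C e"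
    and finite_E: "finite E"
    and nonzero_E: "0 \<notin> E"
    and span_E: "cvec.span E = UNIV"
begin

abbreviation "A \<equiv> generated_algebra T"

lemma subalgebra: "closed_unital_subalgebra A"
  by (rule closed_unital_subalgebra_generated) (rule clinear_T)

lemma A_clinear: "S \<in> A \<Longrightarrow> clinear S"
  and A_id: "id \<in> A"
  and A_add: "S \<in> A \<Longrightarrow> R \<in> A \<Longrightarrow> (\<lambda>x. S x + R x) \<in> A"
  and A_scale: "S \<in> A \<Longrightarrow> (\<lambda>x. c *\<^sub>C S x) \<in> A"
  and A_comp: "S \<in> A \<Longrightarrow> R \<in> A \<Longrightarrow> S \<circ> R \<in> A"
  using subalgebra unfolding closed_unital_subalgebra_def by blast+

lemma A_generator: "set T \<subseteq> A"
  unfolding generated_algebra_def by (rule hull_subset)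

lemma A_common_eigenvalue:
  assumes "S \<in> A" "\<And>t. t \<in> set T \<Longrightarrow> \<exists>c. \<forall>x\<in>P. t x = c *\<^sub>C x"
  shows "\<exists>c. \<forall>x\<in>P. S x = c *\<^sub>C x"
proof -
  have "A \<subseteq> {S. clinear S \<and> (\<exists>c. \<forall>x\<in>P. S x = c *\<^sub>C x)}"
    unfolding generated_algebra_def
    by (rule hull_minimal) (use assms(2) clinear_T closed_unital_subalgebra_common_eigenvalue in auto)
  with assms(1) show ?thesis by blast
qed

lemma A_eigen: "S \<in> A \<Longrightarrow> e \<in> E \<Longrightarrow> \<exists>c. S e = c *\<^sub>C e"
  using A_common_eigenvalue[of S "{e}"] eigen by simp

lemma clinear_eqI:
  assumes "clinear S" "clinear R" "\<And>e. e \<in> E \<Longrightarrow> S e = R e"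
  shows "S = R"
proof
  interpret vector_space_pair scaleC scaleC ..
  show "S x = R x" for x
    by (rule linear_eq_on_span[OF assms(1,2), of E]) (use assms(3) span_E in auto)
qed

text \<open>If the functional differed from evaluation at each element of the eigenbasis, a product of
  operators of the form \<open>S - s id\<close> would vanish without being annihilated by the functional.\<close>

lemma multiplicative_functional_eq_eval:
  assumes "multiplicative_functional A \<psi>"
  shows "\<exists>e\<in>E. \<forall>S\<in>A. S e = \<psi> S *\<^sub>C e"
proof (rule ccontr)
  assume neg: "\<not> ?thesis"
  have add: "\<psi> (\<lambda>x. S x + R x) = \<psi> S + \<psi> R" and scale: "\<psi> (\<lambda>x. c *\<^sub>C S x) = c * \<psi> S"
    and comp: "\<psi> (S \<circ> R) = \<psi> S * \<psi> R" if "S \<in> A" "R \<in> A" for S R c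
    using assms that by (auto simp: multiplicative_functional_def)
  obtain S0 where S0: "S0 \<in> A" "\<psi> S0 \<noteq> 0"
    using assms by (auto simp: multiplicative_functional_def)
  have "\<exists>R\<in>A. (\<forall>e\<in>E'. R e = 0) \<and> \<psi> R \<noteq> 0" if "finite E'" "E' \<subseteq> E" for E'
    using that
  proof (induction E' rule: finite_induct)
    case empty
    then show ?case using S0 by auto
  next
    case (insert f E')
    then obtain R where R: "R \<in> A" "\<forall>e\<in>E'. R e = 0" "\<psi> R \<noteq> 0" by auto
    obtain S where S: "S \<in> A" "S f \<noteq> \<psi> S *\<^sub>C f" using neg insert.prems by auto
    obtain s r where s: "S f = s *\<^sub>C f" and r: "R f = r *\<^sub>C f"
      using A_eigen S(1) R(1) insert.prems by blast
    \<comment> \<open>This is (S - s id) after \<open>R\<close>, expanded so that the value of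
      \<psi> follows without first computing \<psi> at \<open>id\<close>.\<close>
    let ?R = "\<lambda>x. (S \<circ> R) x + (- s) *\<^sub>C R x"
    have lin: "clinear S" using A_clinear[OF S(1)] .
    have "S 0 = 0" using Vector_Spaces.linear.axioms(3)[OF lin] by (rule module_hom.zero)
    then have "?R e = 0" if "e \<in> insert f E'" for e
      using that R(2) lin by (auto simp: r s clinear_iff scaleC_scaleC mult.commute)
    moreover have "\<psi> ?R = (\<psi> S - s) * \<psi> R"
      unfolding add[OF A_comp[OF S(1) R(1)] A_scale[OF R(1)]] scale[OF R(1) R(1)] comp[OF S(1) R(1)]
      by (simp add: left_diff_distrib)
    moreover have "s \<noteq> \<psi> S" using S(2) s by auto
    moreover have "?R \<in> A" by (intro A_add A_comp A_scale S R)
    ultimately show ?case using R(3) by (intro bexI[of _ ?R]) auto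
  qed
  then obtain R where R: "R \<in> A" "\<forall>e\<in>E. R e = 0" "\<psi> R \<noteq> 0"
    using finite_E by blast
  \<comment> \<open>Vanishing on the spanning set \<open>E\<close> makes \<open>R\<close> the zero
    operator, on which homogeneity forces \<psi> to be 0.\<close>
  have "(\<lambda>x. 0 *\<^sub>C R x) = R"
    using R by (intro clinear_eqI A_clinear A_scale) auto
  then have "\<psi> R = 0 * \<psi> R" using scale[OF R(1) R(1), of 0] by simp
  with R(3) show False by simp
qed

text \<open>\<psi> is evaluation at some \<open>e\<close> in \<open>E\<close>, whereas
  \<open>a\<close> need not lie in \<open>E\<close>. But \<open>a\<close> and \<open>e\<close> have
  equal eigenvalues for all generators, so by \<open>A_common_eigenvalue\<close> for the pair they
  have equal eigenvalues for all of \<open>A\<close>.\<close>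

lemma multiplicative_functional_joint_eigenvector:
  assumes "multiplicative_functional A \<psi>" "joint_eigenvector T (map \<psi> T) a" "S \<in> A"
  shows "S a = \<psi> S *\<^sub>C a"
proof -
  obtain e where e: "e \<in> E" "\<And>S. S \<in> A \<Longrightarrow> S e = \<psi> S *\<^sub>C e"
    using multiplicative_functional_eq_eval[OF assms(1)] by blast
  have "\<exists>c. \<forall>x\<in>{a, e}. t x = c *\<^sub>C x" if t: "t \<in> set T" for t
  proof -
    have "t a = \<psi> t *\<^sub>C a"
      using t assms(2) by (auto simp: joint_eigenvector_def in_set_conv_nth)
    moreover have "t e = \<psi> t *\<^sub>C e" using e(2) t A_generator by blast
    ultimately show ?thesis by blast
  qed
  from A_common_eigenvalue[OF assms(3) this]
  obtain c where c: "S a = c *\<^sub>C a" "S e = c *\<^sub>C e" by auto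
  have "c *\<^sub>C e = \<psi> S *\<^sub>C e" using c(2) e(2)[OF assms(3)] by (rule trans[OF sym])
  moreover have "e \<noteq> 0" using e(1) nonzero_E by blast
  ultimately have "c = \<psi> S" by simp
  with c(1) show ?thesis by simp
qed

text \<open>Resolves the definite description. Sending an operator to its eigenvalue at
  \<open>a\<close> is a multiplicative functional, and any other with the same values on
  \<open>T\<close> agrees with it by the preceding lemma.\<close>

lemma spectral_functional_eigenvalue:
  assumes "joint_eigenvector T l a" "S \<in> A"
  shows "S a = spectral_functional T l S *\<^sub>C a"
proof -
  have a: "a \<noteq> 0" and l: "length l = length T" "\<And>j. j < length T \<Longrightarrow> (T ! j) a = (l ! j) *\<^sub>C a"
    using assms(1) by (auto simp: joint_eigenvector_def)
  have "\<exists>c. R a = c *\<^sub>C a" if "R \<in> A" for R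
    using A_common_eigenvalue[OF that, of "{a}"] l by (auto simp: in_set_conv_nth)
  then obtain ev where ev: "\<And>R. R \<in> A \<Longrightarrow> R a = ev R *\<^sub>C a" by metis
  have evI: "ev R = c" if "R \<in> A" "R a = c *\<^sub>C a" for R c
    using ev[OF that(1)] that(2) a by (metis cvec.scale_right_imp_eq)
  \<comment> \<open>\<open>ev\<close> is arbitrary outside \<open>A\<close>; the restriction gives
    the extensional representative that uniqueness requires.\<close>
  define \<psi> where "\<psi> = restrict ev A"
  have "multiplicative_functional A \<psi>"
    unfolding multiplicative_functional_def
  proof (intro conjI ballI allI)
    show "\<psi> \<in> extensional A" by (simp add: \<psi>_def)
    show "\<exists>S\<in>A. \<psi> S \<noteq> 0"
      using evI[OF A_id, of 1] A_id by (intro bexI[of _ id]) (auto simp: \<psi>_def scaleC_one)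
    fix S assume S: "S \<in> A"
    show "\<psi> (\<lambda>x. c *\<^sub>C S x) = c * \<psi> S" for c
      using evI[OF A_scale[OF S], of c "c * ev S"] S
      by (simp add: \<psi>_def A_scale ev scaleC_scaleC)
    fix R assume R: "R \<in> A"
    show "\<psi> (\<lambda>x. S x + R x) = \<psi> S + \<psi> R"
      using evI[OF A_add[OF S R], of "ev S + ev R"] S R
      by (simp add: \<psi>_def A_add ev scaleC_add_left)
    have "(S \<circ> R) a = (ev S * ev R) *\<^sub>C a"
      using A_clinear[OF S] by (simp add: clinear_iff ev S R scaleC_scaleC mult.commute)
    then show "\<psi> (S \<circ> R) = \<psi> S * \<psi> R"
      using evI[OF A_comp[OF S R]] S R by (simp add: \<psi>_def A_comp)
  qed
  moreover have "l = map \<psi> T"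
  proof (rule nth_equalityI)
    fix j assume "j < length l"
    then have "T ! j \<in> A" "(T ! j) a = (l ! j) *\<^sub>C a" using l A_generator by auto
    then show "l ! j = map \<psi> T ! j"
      using evI[of "T ! j" "l ! j"] \<open>j < length l\<close> l(1) by (simp add: \<psi>_def)
  qed (simp add: l)
  ultimately have char: "multiplicative_functional A \<psi> \<and> l = map \<psi> T" ..
  have unique: "\<psi>' = \<psi>" if "multiplicative_functional A \<psi>' \<and> l = map \<psi>' T" for \<psi>'
  proof (rule extensionalityI)
    show "\<psi>' \<in> extensional A" "\<psi> \<in> extensional A"
      using that by (auto simp: multiplicative_functional_def \<psi>_def)
    fix S assume S: "S \<in> A"
    then have "S a = \<psi>' S *\<^sub>C a"
      using that assms(1) by (intro multiplicative_functional_joint_eigenvector) auto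
    from evI[OF S this] show "\<psi>' S = \<psi> S" using S by (simp add: \<psi>_def)
  qed
  have "spectral_functional T l = \<psi>"
    unfolding spectral_functional_def using char unique by (rule the_equality)
  then show ?thesis using ev assms(2) by (simp add: \<psi>_def)
qed

text \<open>The left inverse is corrected one eigenvector at a time: if \<open>S U\<close> fixes the eigenvectors
  treated so far and \<open>U f = \<mu> f\<close>, then \<open>(S + \<mu>\<inverse> (1 - S U)) U\<close> also fixes \<open>f\<close>.\<close>

lemma A_left_inverse:
  assumes U: "U \<in> A" "inj U"
  obtains S where "S \<in> A" "S \<circ> U = id"
proof -
  have U0: "U 0 = 0" using Vector_Spaces.linear.axioms(3)[OF A_clinear[OF U(1)]] by (rule module_hom.zero)
  have "\<exists>S\<in>A. \<forall>e\<in>E'. S (U e) = e" if "finite E'" "E' \<subseteq> E" for E'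
    using that
  proof (induction E' rule: finite_induct)
    case empty
    then show ?case using A_id by auto
  next
    case (insert f E')
    then obtain S where S: "S \<in> A" "\<forall>e\<in>E'. S (U e) = e" by auto
    have lin: "S (x + y) = S x + S y" "S (c *\<^sub>C x) = c *\<^sub>C S x"
      "U (x + y) = U x + U y" "U (c *\<^sub>C x) = c *\<^sub>C U x" for c x y
      using A_clinear[OF S(1)] A_clinear[OF U(1)] by (auto simp: clinear_iff)
    obtain s \<mu> where s: "S f = s *\<^sub>C f" and \<mu>: "U f = \<mu> *\<^sub>C f"
      using A_eigen S(1) U(1) insert.prems by blast
    have "f \<noteq> 0" using insert.prems nonzero_E by auto
    then have "U f \<noteq> 0" using U0 injD[OF U(2), of f 0] by auto
    then have "\<mu> \<noteq> 0" unfolding \<mu> by simp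
    let ?S = "\<lambda>x. S x + inverse \<mu> *\<^sub>C (id x + (- 1) *\<^sub>C (S \<circ> U) x)"
    \<comment> \<open>The correction term vanishes at \<open>U e\<close>, which is a multiple of
      \<open>e\<close> and hence already fixed by \<open>S \<circ> U\<close>.\<close>
    have "?S (U e) = e" if "e \<in> E'" for e
    proof -
      have "e \<in> E" using that insert.prems by blast
      then obtain d where d: "U e = d *\<^sub>C e"
        using A_eigen[OF U(1), of e] by blast
      have SU: "S (U e) = e" using S(2) that by blast
      have "U (U e) = d *\<^sub>C U e"
        using arg_cong[OF d, of U] by (simp only: lin)
      then have "S (U (U e)) = d *\<^sub>C S (U e)" by (simp only: lin)
      also have "\<dots> = U e" by (simp only: SU) (simp only: d)
      finally show ?thesis by (simp add: SU scaleC_one)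
    qed
    moreover have "?S (U f) = f"
    proof -
      have "?S (U f) = (\<mu> * s + inverse \<mu> * (\<mu> - \<mu> * \<mu> * s)) *\<^sub>C f"
        by (simp add: \<mu> s lin scaleC_scaleC scaleC_one cvec.scale_right_diff_distrib
            cvec.scale_left_diff_distrib scaleC_add_left right_diff_distrib mult_ac)
      also have "\<mu> * s + inverse \<mu> * (\<mu> - \<mu> * \<mu> * s) = 1"
        using \<open>\<mu> \<noteq> 0\<close> by (simp add: field_simps)
      finally show ?thesis by (simp add: scaleC_one)
    qed
    moreover have "?S \<in> A"
      by (intro A_add A_scale A_comp A_id S U)
    ultimately show ?case by (intro bexI[of _ ?S]) blast+
  qed
  then obtain S where S: "S \<in> A" "\<forall>e\<in>E. S (U e) = e" using finite_E by blast
  then have "S \<circ> U = id"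
    by (intro clinear_eqI A_clinear A_comp A_id U) auto
  with S(1) show thesis by (rule that)
qed

end


section \<open>The translation space\<close>

lemma d_action_linear_isometry:
  assumes "is_gain_framework F"
  shows "linear_isometry (d_action F \<gamma>)"
proof -
  have "action F \<gamma> \<in> carrier isometry_group"
    using assms by (auto simp: is_gain_framework_def additive_group_def hom_def)
  then obtain U b where "linear_isometry U" "action F \<gamma> = (\<lambda>x. U x + b)"
    by (auto simp: isometry_group_def)
  then show ?thesis by (simp add: linear_part_affine)
qed

lemma d_action_add:
  assumes "is_gain_framework F"
  shows "d_action F (\<gamma> + \<delta>) = d_action F \<gamma> \<circ> d_action F \<delta>"
proof
  fix x
  have lin: "clinear (d_action F \<gamma>)"
    using d_action_linear_isometry[OF assms] by (simp add: linear_isometry_def)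
  interpret L: Vector_Spaces.linear scaleC scaleC "d_action F \<gamma>" by fact
  have "action F (\<gamma> + \<delta>) = action F \<gamma> \<circ> action F \<delta>"
    using assms by (auto simp: is_gain_framework_def additive_group_def isometry_group_def hom_def)
  \<comment> \<open>Subtracting the value at 0 cancels the translation part
    \<open>action F \<gamma> 0\<close>.\<close>
  then have "d_action F (\<gamma> + \<delta>) x = d_action F \<gamma> (action F \<delta> x) - d_action F \<gamma> (action F \<delta> 0)"
    by (simp add: linear_part_def)
  also have "\<dots> = d_action F \<gamma> (d_action F \<delta> x)"
    unfolding L.diff[symmetric] linear_part_def[of "action F \<delta>"] ..
  finally show "d_action F (\<gamma> + \<delta>) x = (d_action F \<gamma> \<circ> d_action F \<delta>) x" by simp
qed

lemma linear_isometry_inj: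
  assumes "linear_isometry U"
  shows "inj U"
proof (rule injI)
  interpret U: Vector_Spaces.linear scaleC scaleC U
    using assms by (simp add: linear_isometry_def)
  fix x y assume "U x = U y"
  then have "norm (U (x - y)) = 0" by (simp add: U.diff)
  then have "norm (x - y) = 0"
    using assms by (simp only: linear_isometry_def)
  then show "x = y" by simp
qed

text \<open>By additivity the operator is idempotent, and an injective idempotent map is the
  identity.\<close>

lemma d_action_zero:
  assumes "is_gain_framework F"
  shows "d_action F 0 = id"
proof
  fix x
  have "d_action F 0 (d_action F 0 x) = d_action F 0 x"
    using fun_cong[OF d_action_add[OF assms, of 0 0], of x] by simp
  then show "d_action F 0 x = id x"
    using injD[OF linear_isometry_inj[OF d_action_linear_isometry[OF assms]]] by auto
qed

lemma d_action_minus: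
  assumes "is_gain_framework F"
  shows "d_action F \<gamma> \<circ> d_action F (- \<gamma>) = id"
  by (simp add: d_action_zero[OF assms] flip: d_action_add[OF assms])

text \<open>Generating a group uses inverses, which an algebra need not contain;
  \<open>A_left_inverse\<close> supplies them. The inclusion makes the spectral functional
  meaningful at every \<open>d_action F \<gamma>\<close>.\<close>

lemma range_d_action_subset_generated_algebra:
  assumes F: "is_gain_framework F" and T: "generating_tuple F T"
    and "diagonalizable_tuple T E"
  shows "range (d_action F) \<subseteq> generated_algebra T"
proof -
  interpret diagonalizable_tuple T E by fact
  have "U \<in> A" if "U \<in> generate unitary_group (set T)" for U
    using that
  proof (induction rule: generate.induct)
    case one
    then show ?case using A_id by (simp add: unitary_group_def id_def)
  next
    case (incl U)
    then show ?case using A_generator by blast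
  next
    case (inv U)
    then obtain \<gamma> where \<gamma>: "U = d_action F \<gamma>"
      using T by (auto simp: generating_tuple_def)
    let ?V = "d_action F (- \<gamma>)"
    have UV: "U \<circ> ?V = id" and VU: "?V \<circ> U = id"
      using d_action_minus[OF F, of \<gamma>] d_action_minus[OF F, of "- \<gamma>"] by (simp_all add: \<gamma>)
    \<comment> \<open>\<open>m_inv\<close> is a definite description, so existence and uniqueness
      are checked directly from the compositions with \<open>U\<close>.\<close>
    have "inv\<^bsub>unitary_group\<^esub> U = ?V"
      unfolding m_inv_def
    proof (rule the_equality)
      show "?V \<in> carrier unitary_group \<and>
          U \<otimes>\<^bsub>unitary_group\<^esub> ?V = \<one>\<^bsub>unitary_group\<^esub> \<and> ?V \<otimes>\<^bsub>unitary_group\<^esub> U = \<one>\<^bsub>unitary_group\<^esub>"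
        using UV VU d_action_linear_isometry[OF F] by (simp add: unitary_group_def)
      fix W assume "W \<in> carrier unitary_group \<and>
          U \<otimes>\<^bsub>unitary_group\<^esub> W = \<one>\<^bsub>unitary_group\<^esub> \<and> W \<otimes>\<^bsub>unitary_group\<^esub> U = \<one>\<^bsub>unitary_group\<^esub>"
      then have "W \<circ> U = id" by (simp add: unitary_group_def)
      then show "W = ?V" using UV by (metis comp_assoc comp_id id_comp)
    qed
    moreover have "U \<in> A" using inv A_generator by blast
    then obtain S where "S \<in> A" "S \<circ> U = id"
      using A_left_inverse linear_isometry_inj[OF d_action_linear_isometry[OF F]] \<gamma> by metis
    moreover from this have "S = ?V" using UV by (metis comp_assoc comp_id id_comp)
    ultimately show ?case by simp
  next
    case (eng U V)
    then show ?case using A_comp[of U V] by (simp add: unitary_group_def comp_def)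
  qed
  then show ?thesis using T by (auto simp: generating_tuple_def)
qed

text \<open>The group is abelian, so all linear parts commute; a common eigenbasis for all of them
  serves in particular for the entries of \<open>T\<close>.\<close>

lemma ex_diagonalizable_tuple:
  fixes F :: "('g::ab_group_add, 'x::fin_dim_hilbert, 'y::fin_dim_hilbert, 'v, 'e) gain_framework"
  assumes F: "is_gain_framework F" and T: "generating_tuple F T"
  shows "\<exists>E. diagonalizable_tuple T E"
proof -
  have comm: "d_action F \<gamma> (d_action F \<delta> x) = d_action F \<delta> (d_action F \<gamma> x)" for \<gamma> \<delta> x
    using d_action_add[OF F, of \<gamma> \<delta>] d_action_add[OF F, of \<delta> \<gamma>]
    by (simp add: add.commute fun_eq_iff)
  have iso: "linear_isometry U" if "U \<in> range (d_action F)" for U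
    using d_action_linear_isometry[OF F] that by auto
  have comm': "U (V x) = V (U x)" if "U \<in> range (d_action F)" "V \<in> range (d_action F)" for U V x
    using comm that by auto
  show ?thesis
  proof (rule ex_orthonormal_eigenbasis[of "range (d_action F)"])
    fix E :: "'x set"
    assume E: "finite E" "\<And>e. e \<in> E \<Longrightarrow> norm e = 1"
      "\<And>x. x = (\<Sum>e\<in>E. cinner x e *\<^sub>C e)"
      "\<And>U e. U \<in> range (d_action F) \<Longrightarrow> e \<in> E \<Longrightarrow> \<exists>c. U e = c *\<^sub>C e"
    have "diagonalizable_tuple T E"
    proof (rule diagonalizable_tuple.intro)
      show "clinear t" if "t \<in> set T" for t
        using iso that T by (auto simp: linear_isometry_def generating_tuple_def)
      show "\<exists>c. t e = c *\<^sub>C e" if "t \<in> set T" "e \<in> E" for t e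
        using E(4) that T unfolding generating_tuple_def by blast
      show "0 \<notin> E" using E(2) by force
      have "(\<Sum>e\<in>E. cinner x e *\<^sub>C e) \<in> cvec.span E" for x
        by (intro cvec.span_sum cvec.span_scale cvec.span_base)
      then have "x \<in> cvec.span E" for x by (subst E(3)[of x])
      then show "cvec.span E = UNIV" by blast
    qed (rule E(1))
    then show ?thesis ..
  qed (fact iso comm')+
qed

lemma symmetric_vector_joint_eigenvector:
  assumes F: "is_gain_framework F" and T: "generating_tuple F T" and a: "joint_eigenvector T l a"
  defines "ch \<equiv> (\<lambda>\<gamma>. cnj (spectral_character F T l \<gamma>))"
  shows "ch \<in> dual_group" "symmetric_vector F ch (const_vector F a) = (\<lambda>\<gamma>. const_vector F a)"
proof -
  obtain E where E: "diagonalizable_tuple T E" using ex_diagonalizable_tuple[OF F T] by blast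
  interpret diagonalizable_tuple T E by fact
  define \<xi> where "\<xi> = spectral_character F T l"
  have ev: "d_action F \<gamma> a = \<xi> \<gamma> *\<^sub>C a" for \<gamma>
    using spectral_functional_eigenvalue[OF a, of "d_action F \<gamma>"]
      range_d_action_subset_generated_algebra[OF F T E]
    by (auto simp: \<xi>_def spectral_character_def)
  have a0: "a \<noteq> 0" using a by (simp add: joint_eigenvector_def)
  have lin: "clinear (d_action F \<gamma>)" for \<gamma>
    using d_action_linear_isometry[OF F] by (simp add: linear_isometry_def)
  have unit: "cmod (\<xi> \<gamma>) = 1" for \<gamma>
    using linear_isometry_eigenvalue[OF d_action_linear_isometry[OF F] ev a0] .
  have mult: "\<xi> (\<gamma> + \<delta>) = \<xi> \<gamma> * \<xi> \<delta>" for \<gamma> \<delta>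
  proof -
    have "\<xi> (\<gamma> + \<delta>) *\<^sub>C a = d_action F \<gamma> (d_action F \<delta> a)"
      by (simp add: d_action_add[OF F] flip: ev)
    also have "\<dots> = (\<xi> \<gamma> * \<xi> \<delta>) *\<^sub>C a"
      using lin[of \<gamma>] by (simp add: ev clinear_iff scaleC_scaleC mult.commute)
    finally show ?thesis using a0 by (metis cvec.scale_right_imp_eq)
  qed
  show "ch \<in> dual_group"
    by (auto simp: dual_group_def hom_def additive_group_def circle_group_def ch_def unit mult
        simp flip: \<xi>_def)
  have "cnj (\<xi> \<gamma>) * \<xi> \<gamma> = 1" for \<gamma>
    using unit[of \<gamma>] by (simp add: mult.commute flip: complex_norm_square)
  \<comment> \<open>Handles the components outside the vertex set, where \<open>const_vector\<close>
    is 0.\<close>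
  moreover have "d_action F \<gamma> 0 = 0" for \<gamma>
    using Vector_Spaces.linear.axioms(3)[OF lin] by (rule module_hom.zero)
  ultimately show "symmetric_vector F ch (const_vector F a) = (\<lambda>\<gamma>. const_vector F a)"
    by (auto simp: symmetric_vector_def const_vector_def fun_eq_iff ev ch_def scaleC_scaleC
        scaleC_one simp flip: \<xi>_def)
qed

text \<open>Constant functions are bounded by \<open>norm a\<close>, so membership in
  \<open>linfty\<close> is automatic.\<close>

lemma translation_space_eq: "translation_space F = range (\<lambda>a \<gamma>. const_vector F a)"
proof -
  have "(\<lambda>\<gamma>. const_vector F a) \<in> linfty F" for a
    by (auto simp: linfty_def vertex_vectors_def const_vector_def intro!: exI[of _ "norm a"])
  then show ?thesis by (auto simp: translation_space_def fun_eq_iff)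
qed

theorem theorem2p18:
  fixes F :: "('g::ab_group_add, 'x::fin_dim_hilbert, 'y::fin_dim_hilbert, 'v, 'e) gain_framework"
    and T :: "('x \<Rightarrow> 'x) list"
  assumes "finitely_generated TYPE('g)"
    and "is_gain_framework F"
    and "generating_tuple F T"
  shows "cfun_span (joint_spectral_symmetric_vectors F T) = translation_space F"
proof -
  \<comment> \<open>\<open>C\<close> is linear, so the span of an image is the image of the span;
    the claim reduces to joint eigenvectors spanning \<open>'x\<close>.\<close>
  define C :: "'x \<Rightarrow> 'g \<Rightarrow> 'v \<Rightarrow> 'x" where "C a = (\<lambda>\<gamma>. const_vector F a)" for a
  interpret C: Vector_Spaces.linear scaleC fun_scaleC C
    by (auto simp: Vector_Spaces.linear_iff cvec.vector_space_axioms cfun.vector_space_axioms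
        C_def const_vector_def fun_scaleC_def fun_eq_iff)
  have "joint_spectral_symmetric_vectors F T = C ` {a. \<exists>l. joint_eigenvector T l a}"
  proof (intro equalityI subsetI)
    fix f assume "f \<in> joint_spectral_symmetric_vectors F T"
    then obtain l a where a: "joint_eigenvector T l a"
      "f = symmetric_vector F (\<lambda>\<gamma>. cnj (spectral_character F T l \<gamma>)) (const_vector F a)"
      by (auto simp: joint_spectral_symmetric_vectors_def)
    have "f = C a"
      unfolding a(2) C_def by (rule symmetric_vector_joint_eigenvector[OF assms(2,3) a(1)])
    with a(1) show "f \<in> C ` {a. \<exists>l. joint_eigenvector T l a}" by blast
  next
    fix f assume "f \<in> C ` {a. \<exists>l. joint_eigenvector T l a}"
    then obtain l a where a: "joint_eigenvector T l a" "f = C a" by blast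
    let ?ch = "\<lambda>\<gamma>. cnj (spectral_character F T l \<gamma>)"
    have "?ch \<in> dual_group" "f = symmetric_vector F ?ch (const_vector F a)"
      using symmetric_vector_joint_eigenvector[OF assms(2,3) a(1)] by (simp_all add: a(2) C_def)
    moreover have "l \<in> joint_spectrum T" using a(1) by (auto simp: joint_spectrum_def)
    ultimately show "f \<in> joint_spectral_symmetric_vectors F T"
      using a(1) unfolding joint_spectral_symmetric_vectors_def by blast
  qed
  moreover have "cvec.span {a. \<exists>l. joint_eigenvector T l a} = UNIV"
  proof -
    obtain E where "diagonalizable_tuple T E"
      using ex_diagonalizable_tuple[OF assms(2,3)] by blast
    then interpret diagonalizable_tuple T E .
    have "\<exists>l. joint_eigenvector T l e" if e: "e \<in> E" for e
    proof -
      \<comment> \<open>Eigenvalues are chosen per operator rather than per index, so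
        \<open>map c T\<close> is the required list.\<close>
      obtain c where "\<And>t. t \<in> set T \<Longrightarrow> t e = c t *\<^sub>C e" using eigen[OF _ e] by metis
      then have "joint_eigenvector T (map c T) e"
        using e nonzero_E by (auto simp: joint_eigenvector_def)
      then show ?thesis ..
    qed
    then have "cvec.span E \<subseteq> cvec.span {a. \<exists>l. joint_eigenvector T l a}"
      by (intro cvec.span_mono) auto
    then show ?thesis using span_E by auto
  qed
  ultimately show ?thesis
    by (simp only: C.span_image) (simp add: translation_space_eq C_def)
qed

end
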